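(* The following statements are equivalent for a ring $R$: (1) $R$ is $P$-symmetric. (2) The ring $S=\{(x,y)\in R\times R\mid x-y\in P(R)\}$ (with componentwise operations) is $P$-symmetric.
   Context: Rings are associative with identity (not necessarily commutative). $P(R)$ denotes the prime radical of a ring $R$ (the intersection of all prime two-sided ideals of $R$). A ring $R$ is $P$-symmetric if for any $a,b,c\in R$, $abc=0$ implies $bac\in P(R)$. *)

theory Defs
  imports "HOL-Algebra.Algebra"
begin

text \<open>The locale \<open>primeideal\<close> of HOL-Algebra requires a commutative ring (and is phrased
  elementwise), so the notion of a prime two-sided ideal of an arbitrary ring is introduced here.
  In HOL-Algebra, \<open>ideal\<close> means two-sided ideal and \<open>ideal_prod R I J\<close> is the set of finite
  nonempty sums of products \<open>i \<otimes> j\<close> with \<open>i \<in> I\<close> and \<open>j \<in> J\<close>.\<close>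

definition nc_prime_ideal :: "'a set \<Rightarrow> ('a, 'm) ring_scheme \<Rightarrow> bool"
  where "nc_prime_ideal Q R \<longleftrightarrow>
    ideal Q R \<and> Q \<noteq> carrier R \<and>
    (\<forall>I J. ideal I R \<longrightarrow> ideal J R \<longrightarrow> ideal_prod R I J \<subseteq> Q \<longrightarrow> I \<subseteq> Q \<or> J \<subseteq> Q)"

text \<open>Intersecting with the carrier only matters for the zero ring, which has no prime ideals and
  is its own prime radical.\<close>

definition prime_radical :: "('a, 'm) ring_scheme \<Rightarrow> 'a set"
  where "prime_radical R = carrier R \<inter> \<Inter> {Q. nc_prime_ideal Q R}"

definition P_symmetric :: "('a, 'm) ring_scheme \<Rightarrow> bool"
  where "P_symmetric R \<longleftrightarrow>
    (\<forall>a \<in> carrier R. \<forall>b \<in> carrier R. \<forall>c \<in> carrier R.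
      a \<otimes>\<^bsub>R\<^esub> b \<otimes>\<^bsub>R\<^esub> c = \<zero>\<^bsub>R\<^esub> \<longrightarrow> b \<otimes>\<^bsub>R\<^esub> a \<otimes>\<^bsub>R\<^esub> c \<in> prime_radical R)"

definition P_pair_ring :: "('a, 'm) ring_scheme \<Rightarrow> ('a \<times> 'a) ring"
  where "P_pair_ring R = (RDirProd R R)
    \<lparr> carrier := {(x, y). x \<in> carrier R \<and> y \<in> carrier R \<and> x \<ominus>\<^bsub>R\<^esub> y \<in> prime_radical R} \<rparr>"

lemma prime_radical_ideal:
  assumes "ring R"
  shows "ideal (prime_radical R) R"
proof -
  interpret ring R by fact
  have "ideal (\<Inter> (insert (carrier R) {Q. nc_prime_ideal Q R})) R"
    by (rule i_Intersect) (auto simp: nc_prime_ideal_def oneideal)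
  then show ?thesis
    by (simp add: prime_radical_def)
qed

lemma P_pair_ring_is_ring:
  assumes "ring R"
  shows "ring (P_pair_ring R)"
proof -
  interpret R: ring R by fact
  interpret P: ideal "prime_radical R" R
    by (rule prime_radical_ideal) fact
  let ?D = "RDirProd R R"
  let ?H = "{(x, y). x \<in> carrier R \<and> y \<in> carrier R \<and> x \<ominus>\<^bsub>R\<^esub> y \<in> prime_radical R}"
  interpret D: ring ?D
    by (rule RDirProd_ring) fact+
  have ops: "\<And>a b c d. (a, b) \<otimes>\<^bsub>?D\<^esub> (c, d) = (a \<otimes>\<^bsub>R\<^esub> c, b \<otimes>\<^bsub>R\<^esub> d)"
    "\<And>a b c d. (a, b) \<oplus>\<^bsub>?D\<^esub> (c, d) = (a \<oplus>\<^bsub>R\<^esub> c, b \<oplus>\<^bsub>R\<^esub> d)"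
    "\<one>\<^bsub>?D\<^esub> = (\<one>\<^bsub>R\<^esub>, \<one>\<^bsub>R\<^esub>)" "\<zero>\<^bsub>?D\<^esub> = (\<zero>\<^bsub>R\<^esub>, \<zero>\<^bsub>R\<^esub>)"
    by (simp_all add: RDirProd_def DirProd_def monoid.defs)
  have carr: "carrier ?D = carrier R \<times> carrier R"
    by (rule RDirProd_carrier)
  have neg: "\<ominus>\<^bsub>?D\<^esub> (a, b) = (\<ominus>\<^bsub>R\<^esub> a, \<ominus>\<^bsub>R\<^esub> b)" if "a \<in> carrier R" "b \<in> carrier R" for a b
    by (rule D.minus_equality) (use that in \<open>simp_all add: ops carr R.l_neg\<close>)
  have "subring ?H ?D"
  proof (rule D.subringI)
    show "?H \<subseteq> carrier ?D"
      by (auto simp: carr)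
    show "\<one>\<^bsub>?D\<^esub> \<in> ?H"
      by (simp add: ops a_minus_def R.r_neg)
  next
    fix h assume h: "h \<in> ?H"
    then obtain x y where xy: "h = (x, y)" "x \<in> carrier R" "y \<in> carrier R"
      "x \<ominus>\<^bsub>R\<^esub> y \<in> prime_radical R" by auto
    have "\<ominus>\<^bsub>R\<^esub> x \<ominus>\<^bsub>R\<^esub> (\<ominus>\<^bsub>R\<^esub> y) = \<ominus>\<^bsub>R\<^esub> (x \<ominus>\<^bsub>R\<^esub> y)"
      using xy by (simp add: a_minus_def R.minus_add)
    then show "\<ominus>\<^bsub>?D\<^esub> h \<in> ?H"
      using xy by (simp add: neg P.a_inv_closed)
  next
    fix h k assume "h \<in> ?H" "k \<in> ?H"
    then obtain x y u v where
      xy: "h = (x, y)" "x \<in> carrier R" "y \<in> carrier R" "x \<ominus>\<^bsub>R\<^esub> y \<in> prime_radical R" and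
      uv: "k = (u, v)" "u \<in> carrier R" "v \<in> carrier R" "u \<ominus>\<^bsub>R\<^esub> v \<in> prime_radical R"
      by auto
    have "x \<otimes>\<^bsub>R\<^esub> u \<ominus>\<^bsub>R\<^esub> y \<otimes>\<^bsub>R\<^esub> v = (x \<ominus>\<^bsub>R\<^esub> y) \<otimes>\<^bsub>R\<^esub> u \<oplus>\<^bsub>R\<^esub> y \<otimes>\<^bsub>R\<^esub> (u \<ominus>\<^bsub>R\<^esub> v)"
      using xy uv by algebra
    then show "h \<otimes>\<^bsub>?D\<^esub> k \<in> ?H"
      using xy uv by (simp add: ops P.a_closed P.I_l_closed P.I_r_closed)
    have "(x \<oplus>\<^bsub>R\<^esub> u) \<ominus>\<^bsub>R\<^esub> (y \<oplus>\<^bsub>R\<^esub> v) = (x \<ominus>\<^bsub>R\<^esub> y) \<oplus>\<^bsub>R\<^esub> (u \<ominus>\<^bsub>R\<^esub> v)"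
      using xy uv by algebra
    then show "h \<oplus>\<^bsub>?D\<^esub> k \<in> ?H"
      using xy uv by (simp add: ops P.a_closed)
  qed
  then show ?thesis
    unfolding P_pair_ring_def by (rule D.subring_is_ring)
qed

end

theory Submission
  imports Defs
begin

text \<open>The point is that the prime radical of \<open>S\<close> is \<open>S \<inter> (P(R) \<times> P(R))\<close>. Both coordinate
  projections \<open>S \<rightarrow> R\<close> are surjective (use the diagonal), so primes of \<open>R\<close> pull back to primes of
  \<open>S\<close>. Conversely, the kernels of the two projections have product zero, so every prime \<open>Q\<close> of
  \<open>S\<close> contains one of them; then \<open>Q\<close> is the preimage of a prime of \<open>R\<close> under that projection,
  hence contains every pair whose coordinates lie in \<open>P(R)\<close>.\<close>

section \<open>Elementwise tests for primeness\<close>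

text \<open>An ideal is closed under addition, so single products in \<open>Q\<close> already force
  their finite sums into \<open>Q\<close>. Primeness can therefore be handled without
  \<open>ideal_prod\<close>.\<close>

lemma ideal_prod_subset_iff:
  assumes "ideal Q R"
  shows "ideal_prod R I J \<subseteq> Q \<longleftrightarrow> (\<forall>i\<in>I. \<forall>j\<in>J. i \<otimes>\<^bsub>R\<^esub> j \<in> Q)"
proof
  assume "ideal_prod R I J \<subseteq> Q"
  then show "\<forall>i\<in>I. \<forall>j\<in>J. i \<otimes>\<^bsub>R\<^esub> j \<in> Q"
    by (auto intro: ideal_prod.prod)
next
  interpret Q: ideal Q R by fact
  assume *: "\<forall>i\<in>I. \<forall>j\<in>J. i \<otimes>\<^bsub>R\<^esub> j \<in> Q"
  show "ideal_prod R I J \<subseteq> Q"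
  proof
    fix s assume "s \<in> ideal_prod R I J"
    then show "s \<in> Q"
      by induction (use * in \<open>auto intro: Q.a_closed\<close>)
  qed
qed

lemma nc_prime_idealD:
  assumes "nc_prime_ideal Q R" "ideal I R" "ideal J R"
    and "\<And>i j. i \<in> I \<Longrightarrow> j \<in> J \<Longrightarrow> i \<otimes>\<^bsub>R\<^esub> j \<in> Q"
  shows "I \<subseteq> Q \<or> J \<subseteq> Q"
  using assms by (simp add: nc_prime_ideal_def ideal_prod_subset_iff)

lemma nc_prime_idealI:
  assumes "ideal Q R" "Q \<noteq> carrier R"
    and "\<And>I J. \<lbrakk>ideal I R; ideal J R; \<forall>i\<in>I. \<forall>j\<in>J. i \<otimes>\<^bsub>R\<^esub> j \<in> Q\<rbrakk> \<Longrightarrow> I \<subseteq> Q \<or> J \<subseteq> Q"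
  shows "nc_prime_ideal Q R"
  using assms by (simp add: nc_prime_ideal_def ideal_prod_subset_iff)

section \<open>Ideals and primes along surjective homomorphisms\<close>

context ring_hom_ring
begin

text \<open>Absorption is where surjectivity enters: a multiplier in \<open>S\<close> is lifted to
  \<open>R\<close>, where \<open>I\<close> absorbs it.\<close>

lemma ideal_image_surj:
  assumes surj: "h ` carrier R = carrier S" and I: "ideal I R"
  shows "ideal (h ` I) S"
proof -
  interpret I: ideal I R by fact
  show ?thesis
  proof (rule idealI)
    show "ring S"
      by (rule S.ring_axioms)
    show "subgroup (h ` I) (add_monoid S)"
      by (rule group_hom.subgroup_img_is_subgroup[OF a_group_hom I.a_subgroup])
  next
    fix a x assume "a \<in> h ` I" "x \<in> carrier S"
    then obtain b y where b: "b \<in> I" "a = h b" and y: "y \<in> carrier R" "x = h y"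
      using surj by blast
    have "x \<otimes>\<^bsub>S\<^esub> a = h (y \<otimes> b)" "a \<otimes>\<^bsub>S\<^esub> x = h (b \<otimes> y)"
      using b y I.Icarr by simp_all
    then show "x \<otimes>\<^bsub>S\<^esub> a \<in> h ` I" "a \<otimes>\<^bsub>S\<^esub> x \<in> h ` I"
      using b(1) y(1) by (metis I.I_l_closed I.I_r_closed imageI)+
  qed
qed

text \<open>Ideals \<open>I\<close>, \<open>J\<close> of \<open>R\<close> are pushed forward to
  ideals of \<open>S\<close>, where the primeness of \<open>Q\<close> decides. Surjectivity also
  makes the preimage proper, since an element outside \<open>Q\<close> has a lift.\<close>

lemma nc_prime_ideal_vimage:
  assumes surj: "h ` carrier R = carrier S" and Q: "nc_prime_ideal Q S"
  shows "nc_prime_ideal {r \<in> carrier R. h r \<in> Q} R"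
proof (rule nc_prime_idealI)
  have QS: "ideal Q S" "Q \<noteq> carrier S"
    using Q by (auto simp: nc_prime_ideal_def)
  then show "ideal {r \<in> carrier R. h r \<in> Q} R"
    by (intro ideal_vimage)
  have "Q \<subseteq> carrier S"
    using QS by (auto dest: ideal.Icarr)
  then obtain s where "s \<in> carrier S" "s \<notin> Q"
    using QS(2) by auto
  then obtain r where "r \<in> carrier R" "h r \<notin> Q"
    using surj by (metis imageE)
  then show "{r \<in> carrier R. h r \<in> Q} \<noteq> carrier R"
    by auto
next
  fix I J
  assume I: "ideal I R" and J: "ideal J R"
    and IJ: "\<forall>i\<in>I. \<forall>j\<in>J. i \<otimes> j \<in> {r \<in> carrier R. h r \<in> Q}"
  have carr: "I \<subseteq> carrier R" "J \<subseteq> carrier R"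
    using I J by (auto dest: ideal.Icarr)
  have "h ` I \<subseteq> Q \<or> h ` J \<subseteq> Q"
  proof (rule nc_prime_idealD[OF Q])
    show "ideal (h ` I) S" "ideal (h ` J) S"
      using I J surj by (auto intro: ideal_image_surj)
    fix i j assume "i \<in> h ` I" "j \<in> h ` J"
    then obtain i' j' where "i' \<in> I" "i = h i'" "j' \<in> J" "j = h j'"
      by blast
    moreover from this have "h (i' \<otimes> j') = i \<otimes>\<^bsub>S\<^esub> j"
      using carr by (metis hom_mult subsetD)
    ultimately show "i \<otimes>\<^bsub>S\<^esub> j \<in> Q"
      using IJ by force
  qed
  then show "I \<subseteq> {r \<in> carrier R. h r \<in> Q} \<or> J \<subseteq> {r \<in> carrier R. h r \<in> Q}"
    using carr by blast
qed

text \<open>An element with the same image as some \<open>q\<close> in \<open>Q\<close> differs from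
  \<open>q\<close> by a kernel element, hence by an element of \<open>Q\<close>. So \<open>Q\<close>
  is the full preimage of its image.\<close>

lemma mem_ideal_if_hom_mem_image:
  assumes Q: "ideal Q R" and ker: "a_kernel R S h \<subseteq> Q"
    and r: "r \<in> carrier R" "h r \<in> h ` Q"
  shows "r \<in> Q"
proof -
  interpret Q: ideal Q R by fact
  obtain q where q: "q \<in> Q" "h r = h q"
    using r by blast
  then have qc: "q \<in> carrier R"
    using Q.Icarr by blast
  have "h (r \<ominus> q) = \<zero>\<^bsub>S\<^esub>"
    using r qc q by (simp add: a_minus_def S.r_neg)
  moreover have "r \<ominus> q \<in> carrier R"
    using r qc by (intro R.minus_closed)
  ultimately have "r \<ominus> q \<in> Q"
    using ker unfolding a_kernel_def' by blast
  then have "(r \<ominus> q) \<oplus> q \<in> Q"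
    using q by (intro Q.a_closed)
  moreover have "(r \<ominus> q) \<oplus> q = r"
    using r qc by algebra
  ultimately show ?thesis
    by simp
qed

lemma nc_prime_ideal_image:
  assumes surj: "h ` carrier R = carrier S" and Q: "nc_prime_ideal Q R"
    and ker: "a_kernel R S h \<subseteq> Q"
  shows "nc_prime_ideal (h ` Q) S"
proof (rule nc_prime_idealI)
  have QR: "ideal Q R" "Q \<noteq> carrier R"
    using Q by (auto simp: nc_prime_ideal_def)
  then show "ideal (h ` Q) S"
    using surj by (intro ideal_image_surj)
  note lift = mem_ideal_if_hom_mem_image[OF QR(1) ker]
  have "Q \<subseteq> carrier R"
    using QR by (auto dest: ideal.Icarr)
  \<comment> \<open>If the image of \<open>Q\<close> were all of \<open>S\<close>, then
    \<open>lift\<close> would put every element of \<open>R\<close> into \<open>Q\<close>.\<close>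
  then show "h ` Q \<noteq> carrier S"
    using QR lift by auto
  fix I J
  assume I: "ideal I S" and J: "ideal J S" and IJ: "\<forall>i\<in>I. \<forall>j\<in>J. i \<otimes>\<^bsub>S\<^esub> j \<in> h ` Q"
  \<comment> \<open>The ideals are pulled back to \<open>R\<close>; a product of elements of the
    preimages maps into the image of \<open>Q\<close>, so \<open>lift\<close> places it in
    \<open>Q\<close>.\<close>
  have "{r \<in> carrier R. h r \<in> I} \<subseteq> Q \<or> {r \<in> carrier R. h r \<in> J} \<subseteq> Q"
    using I J IJ by (intro nc_prime_idealD[OF Q] ideal_vimage lift) auto
  \<comment> \<open>Hence each of \<open>I\<close> and \<open>J\<close> is the image of its
    preimage, and the inclusion can be pushed forward again.\<close>
  moreover have "I \<subseteq> h ` carrier R" "J \<subseteq> h ` carrier R"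
    unfolding surj using I J by (auto dest: ideal.Icarr)
  ultimately show "I \<subseteq> h ` Q \<or> J \<subseteq> h ` Q"
    by blast
qed

lemma hom_prime_radical:
  assumes "h ` carrier R = carrier S" "r \<in> prime_radical R"
  shows "h r \<in> prime_radical S"
  using assms nc_prime_ideal_vimage by (fastforce simp: prime_radical_def)

text \<open>The image of \<open>Q\<close> is a prime of \<open>S\<close>, so it contains
  \<open>h r\<close>; the kernel condition brings this back to \<open>r\<close>.\<close>

lemma mem_nc_prime_ideal_if_hom_prime_radical:
  assumes "h ` carrier R = carrier S" "nc_prime_ideal Q R" "a_kernel R S h \<subseteq> Q"
    and "r \<in> carrier R" "h r \<in> prime_radical S"
  shows "r \<in> Q"
proof (rule mem_ideal_if_hom_mem_image)
  show "ideal Q R"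
    using assms(2) by (simp add: nc_prime_ideal_def)
  show "h r \<in> h ` Q"
    using assms nc_prime_ideal_image[OF assms(1-3)] by (auto simp: prime_radical_def)
qed fact+

end

section \<open>The pair ring, its projections and its prime radical\<close>

lemma P_pair_ring_simps:
  "carrier (P_pair_ring R) =
    {(x, y). x \<in> carrier R \<and> y \<in> carrier R \<and> x \<ominus>\<^bsub>R\<^esub> y \<in> prime_radical R}"
  "(a, b) \<otimes>\<^bsub>P_pair_ring R\<^esub> (c, d) = (a \<otimes>\<^bsub>R\<^esub> c, b \<otimes>\<^bsub>R\<^esub> d)"
  "(a, b) \<oplus>\<^bsub>P_pair_ring R\<^esub> (c, d) = (a \<oplus>\<^bsub>R\<^esub> c, b \<oplus>\<^bsub>R\<^esub> d)"
  "\<one>\<^bsub>P_pair_ring R\<^esub> = (\<one>\<^bsub>R\<^esub>, \<one>\<^bsub>R\<^esub>)"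
  "\<zero>\<^bsub>P_pair_ring R\<^esub> = (\<zero>\<^bsub>R\<^esub>, \<zero>\<^bsub>R\<^esub>)"
  by (simp_all add: P_pair_ring_def RDirProd_def DirProd_def monoid.defs)

context ring
begin

text \<open>The diagonal copy of \<open>R\<close> makes both projections surjective and later
  carries relations of \<open>R\<close> into the pair ring.\<close>

lemma diagonal_mem_P_pair_ring:
  assumes "x \<in> carrier R"
  shows "(x, x) \<in> carrier (P_pair_ring R)"
proof -
  interpret P: ideal "prime_radical R" R
    by (rule prime_radical_ideal) (rule ring_axioms)
  show ?thesis
    using assms by (simp add: P_pair_ring_simps a_minus_def r_neg)
qed

lemma ring_hom_ring_fst: "ring_hom_ring (P_pair_ring R) R fst"
  and ring_hom_ring_snd: "ring_hom_ring (P_pair_ring R) R snd"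
  by (rule ring_hom_ringI; use P_pair_ring_is_ring ring_axioms in
      \<open>auto simp: P_pair_ring_simps\<close>)+

lemma fst_P_pair_ring: "fst ` carrier (P_pair_ring R) = carrier R"
  and snd_P_pair_ring: "snd ` carrier (P_pair_ring R) = carrier R"
  using diagonal_mem_P_pair_ring by (force simp: P_pair_ring_simps)+

lemma nc_prime_ideal_P_pair_ring_kernel:
  assumes "nc_prime_ideal Q (P_pair_ring R)"
  shows "a_kernel (P_pair_ring R) R fst \<subseteq> Q \<or> a_kernel (P_pair_ring R) R snd \<subseteq> Q"
proof (rule nc_prime_idealD[OF assms])
  show "ideal (a_kernel (P_pair_ring R) R fst) (P_pair_ring R)"
    by (rule ring_hom_ring.kernel_is_ideal[OF ring_hom_ring_fst])
  show "ideal (a_kernel (P_pair_ring R) R snd) (P_pair_ring R)"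
    by (rule ring_hom_ring.kernel_is_ideal[OF ring_hom_ring_snd])
next
  interpret Q: ideal Q "P_pair_ring R"
    using assms by (simp add: nc_prime_ideal_def)
  fix i j
  assume "i \<in> a_kernel (P_pair_ring R) R fst" "j \<in> a_kernel (P_pair_ring R) R snd"
  \<comment> \<open>The first coordinate of \<open>i\<close> and the second coordinate of
    \<open>j\<close> are zero.\<close>
  then have "i \<otimes>\<^bsub>P_pair_ring R\<^esub> j = \<zero>\<^bsub>P_pair_ring R\<^esub>"
    by (auto simp: a_kernel_def' P_pair_ring_simps)
  then show "i \<otimes>\<^bsub>P_pair_ring R\<^esub> j \<in> Q"
    by simp
qed

lemma prime_radical_P_pair_ring_iff:
  assumes "(x, y) \<in> carrier (P_pair_ring R)"
  shows "(x, y) \<in> prime_radical (P_pair_ring R) \<longleftrightarrow>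
    x \<in> prime_radical R \<and> y \<in> prime_radical R"
proof
  assume "(x, y) \<in> prime_radical (P_pair_ring R)"
  then show "x \<in> prime_radical R \<and> y \<in> prime_radical R"
    using ring_hom_ring.hom_prime_radical[OF ring_hom_ring_fst fst_P_pair_ring]
      ring_hom_ring.hom_prime_radical[OF ring_hom_ring_snd snd_P_pair_ring] by fastforce
next
  assume xy: "x \<in> prime_radical R \<and> y \<in> prime_radical R"
  \<comment> \<open>The coordinate used is the one whose projection has its kernel inside
    \<open>Q\<close>.\<close>
  have "(x, y) \<in> Q" if Q: "nc_prime_ideal Q (P_pair_ring R)" for Q
    using nc_prime_ideal_P_pair_ring_kernel[OF Q]
  proof
    assume "a_kernel (P_pair_ring R) R fst \<subseteq> Q"
    from ring_hom_ring.mem_nc_prime_ideal_if_hom_prime_radical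
      [OF ring_hom_ring_fst fst_P_pair_ring Q this assms]
    show ?thesis using xy by simp
  next
    assume "a_kernel (P_pair_ring R) R snd \<subseteq> Q"
    from ring_hom_ring.mem_nc_prime_ideal_if_hom_prime_radical
      [OF ring_hom_ring_snd snd_P_pair_ring Q this assms]
    show ?thesis using xy by simp
  qed
  then show "(x, y) \<in> prime_radical (P_pair_ring R)"
    using assms by (simp add: prime_radical_def)
qed

end

theorem theorem2p23:
  fixes R :: "('a, 'm) ring_scheme"
  assumes "ring R"
  shows "P_symmetric R \<longleftrightarrow> P_symmetric (P_pair_ring R)"
proof
  interpret R: ring R by fact
  interpret S: ring "P_pair_ring R"
    by (rule P_pair_ring_is_ring) fact
  show "P_symmetric (P_pair_ring R)" if sym: "P_symmetric R"
    unfolding P_symmetric_def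
  proof (intro ballI impI)
    fix a b c
    assume abc: "a \<in> carrier (P_pair_ring R)" "b \<in> carrier (P_pair_ring R)"
        "c \<in> carrier (P_pair_ring R)"
      and zero: "a \<otimes>\<^bsub>P_pair_ring R\<^esub> b \<otimes>\<^bsub>P_pair_ring R\<^esub> c = \<zero>\<^bsub>P_pair_ring R\<^esub>"
    obtain a1 a2 b1 b2 c1 c2 where eqs: "a = (a1, a2)" "b = (b1, b2)" "c = (c1, c2)"
      by (metis surj_pair)
    \<comment> \<open>The coordinatewise description of the radical applies only to pairs known to
      lie in the pair ring.\<close>
    have "b \<otimes>\<^bsub>P_pair_ring R\<^esub> a \<otimes>\<^bsub>P_pair_ring R\<^esub> c \<in> carrier (P_pair_ring R)"
      using abc by simp
    moreover have "b1 \<otimes>\<^bsub>R\<^esub> a1 \<otimes>\<^bsub>R\<^esub> c1 \<in> prime_radical R"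
      "b2 \<otimes>\<^bsub>R\<^esub> a2 \<otimes>\<^bsub>R\<^esub> c2 \<in> prime_radical R"
      using sym abc zero unfolding P_symmetric_def eqs by (simp_all add: P_pair_ring_simps)
    ultimately show "b \<otimes>\<^bsub>P_pair_ring R\<^esub> a \<otimes>\<^bsub>P_pair_ring R\<^esub> c \<in> prime_radical (P_pair_ring R)"
      unfolding eqs P_pair_ring_simps(2) by (simp add: R.prime_radical_P_pair_ring_iff)
  qed
  show "P_symmetric R" if sym: "P_symmetric (P_pair_ring R)"
    unfolding P_symmetric_def
  proof (intro ballI impI)
    fix a b c
    assume abc: "a \<in> carrier R" "b \<in> carrier R" "c \<in> carrier R"
      and zero: "a \<otimes>\<^bsub>R\<^esub> b \<otimes>\<^bsub>R\<^esub> c = \<zero>\<^bsub>R\<^esub>"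
    \<comment> \<open>The relation is moved to the diagonal, where the symmetry of the pair ring
      applies; either coordinate of the result then gives the claim.\<close>
    have "(b, b) \<otimes>\<^bsub>P_pair_ring R\<^esub> (a, a) \<otimes>\<^bsub>P_pair_ring R\<^esub> (c, c) \<in> prime_radical (P_pair_ring R)"
      using sym[unfolded P_symmetric_def, rule_format, of "(a, a)" "(b, b)" "(c, c)"] zero abc
      by (simp add: P_pair_ring_simps(2,5) R.diagonal_mem_P_pair_ring)
    then show "b \<otimes>\<^bsub>R\<^esub> a \<otimes>\<^bsub>R\<^esub> c \<in> prime_radical R"
      using abc by (simp add: P_pair_ring_simps(2) R.prime_radical_P_pair_ring_iff
          R.diagonal_mem_P_pair_ring)
  qed
qed

end
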